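(* Let $\mathcal C$ be the symmetric monoidal closed category freely generated by a closed monoidal signature $\Sigma=(\Sigma_0,\Sigma_1)$. Then every morphism $f$ of $\mathcal C$ can be presented as a hierarchical foliation, i.e. \[ f=\Bigl(\bigotimes_{i}f_{1,i}\Bigr)\,;\,\cdots\,;\,\Bigl(\bigotimes_{i}f_{n,i}\Bigr), \] where each $f_{j,i}$ is either a generating morphism in $\Sigma_1$, a structural morphism, or $\Lambda_X(f')$ for some object $X$ and some morphism $f'$ which itself is presented as a hierarchical foliation.
   Context: Composition is written in diagrammatic order, $f;g:=g\circ f$. A closed monoidal signature is a pair $\Sigma=(\Sigma_0,\Sigma_1)$ where $\Sigma_0$ is a set of generating objects and $\Sigma_1$ a set of generating morphisms with sources and targets in $\mathrm{obj}_{\Sigma_0}$, the set of objects built inductively from a unit $I$ and elements of $\Sigma_0$ using $\otimes$ and $\multimap$. The freely generated symmetric monoidal closed category $\mathcal C$ has objects $\mathrm{obj}_{\Sigma_0}$ and morphisms the terms built from generators in $\Sigma_1$, identities, symmetries $\sigma_{A,B}$, evaluations $\mathrm{eval}_{X,A}:(X\multimap A)\otimes X\to A$, sequential composition, tensor, and abstraction (from $h:X\otimes A\to Y$ one forms $\Lambda_X(h):A\to X\multimap Y$), quotiented by the axioms of (non-strict) symmetric monoidal categories and the equations $(\Lambda_X(h)\otimes\mathrm{id}_X);\mathrm{eval}_{X,Y}=\sigma_{A,X};h$, $\Lambda_X(\sigma_{X,X\multimap Y};\mathrm{eval}_{X,Y})=\mathrm{id}_{X\multimap Y}$, and $f;\Lambda_X(g)=\Lambda_X((\mathrm{id}_X\otimes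 f);g)$. Structural morphisms are identities, symmetries, evaluation maps, and the associativity and unit isomorphisms of $\otimes$. *)

theory Defs
  imports Main
begin

datatype 'o obj =
    Unit
  | Atom 'o
  | Tensor "'o obj" "'o obj"  (infixr \<open>\<otimes>\<close> 72)
  | Hom "'o obj" "'o obj"  (infixr \<open>\<multimap>\<close> 71)

record ('o, 'm) signature =
  gen_objs :: "'o set"
  gen_mors :: "'m set"
  source :: "'m \<Rightarrow> 'o obj"
  target :: "'m \<Rightarrow> 'o obj"

inductive_set objs :: "('o, 'm) signature \<Rightarrow> 'o obj set"
  for S :: "('o, 'm) signature" where
  "Unit \<in> objs S"
| "a \<in> gen_objs S \<Longrightarrow> Atom a \<in> objs S"
| "\<lbrakk>A \<in> objs S; B \<in> objs S\<rbrakk> \<Longrightarrow> A \<otimes> B \<in> objs S"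
| "\<lbrakk>A \<in> objs S; B \<in> objs S\<rbrakk> \<Longrightarrow> A \<multimap> B \<in> objs S"

definition closed_monoidal_signature :: "('o, 'm) signature \<Rightarrow> bool" where
  "closed_monoidal_signature S \<longleftrightarrow>
     (\<forall>m \<in> gen_mors S. source S m \<in> objs S \<and> target S m \<in> objs S)"

text \<open>
  Raw morphism terms. Composition \<open>f ;; g\<close> is in diagrammatic order. The tensor is not strict,
  so the associator, the unitors and their inverses are term constructors.
\<close>

datatype ('o, 'm) trm =
    Gen 'm
  | Ident "'o obj"
  | Sym "'o obj" "'o obj"
  | Eval "'o obj" "'o obj"
  | Assoc "'o obj" "'o obj" "'o obj"
  | AssocInv "'o obj" "'o obj" "'o obj"
  | LUnit "'o obj"
  | LUnitInv "'o obj"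
  | RUnit "'o obj"
  | RUnitInv "'o obj"
  | Seq "('o, 'm) trm" "('o, 'm) trm"  (infixl \<open>;;\<close> 60)
  | Par "('o, 'm) trm" "('o, 'm) trm"  (infixr \<open>\<parallel>\<close> 65)
  | Lam "'o obj" "('o, 'm) trm"

inductive has_type :: "('o, 'm) signature \<Rightarrow> ('o, 'm) trm \<Rightarrow> 'o obj \<Rightarrow> 'o obj \<Rightarrow> bool"
  for S :: "('o, 'm) signature" where
  ty_gen: "m \<in> gen_mors S \<Longrightarrow> has_type S (Gen m) (source S m) (target S m)"
| ty_id: "A \<in> objs S \<Longrightarrow> has_type S (Ident A) A A"
| ty_sym: "\<lbrakk>A \<in> objs S; B \<in> objs S\<rbrakk> \<Longrightarrow> has_type S (Sym A B) (A \<otimes> B) (B \<otimes> A)"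
| ty_eval: "\<lbrakk>X \<in> objs S; A \<in> objs S\<rbrakk> \<Longrightarrow> has_type S (Eval X A) ((X \<multimap> A) \<otimes> X) A"
| ty_assoc: "\<lbrakk>A \<in> objs S; B \<in> objs S; C \<in> objs S\<rbrakk> \<Longrightarrow>
    has_type S (Assoc A B C) ((A \<otimes> B) \<otimes> C) (A \<otimes> (B \<otimes> C))"
| ty_assoc_inv: "\<lbrakk>A \<in> objs S; B \<in> objs S; C \<in> objs S\<rbrakk> \<Longrightarrow>
    has_type S (AssocInv A B C) (A \<otimes> (B \<otimes> C)) ((A \<otimes> B) \<otimes> C)"
| ty_lunit: "A \<in> objs S \<Longrightarrow> has_type S (LUnit A) (Unit \<otimes> A) A"
| ty_lunit_inv: "A \<in> objs S \<Longrightarrow> has_type S (LUnitInv A) A (Unit \<otimes> A)"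
| ty_runit: "A \<in> objs S \<Longrightarrow> has_type S (RUnit A) (A \<otimes> Unit) A"
| ty_runit_inv: "A \<in> objs S \<Longrightarrow> has_type S (RUnitInv A) A (A \<otimes> Unit)"
| ty_seq: "\<lbrakk>has_type S f A B; has_type S g B C\<rbrakk> \<Longrightarrow> has_type S (f ;; g) A C"
| ty_par: "\<lbrakk>has_type S f A B; has_type S g C D\<rbrakk> \<Longrightarrow> has_type S (f \<parallel> g) (A \<otimes> C) (B \<otimes> D)"
| ty_lam: "has_type S h (X \<otimes> A) Y \<Longrightarrow> has_type S (Lam X h) A (X \<multimap> Y)"

text \<open>
  The congruence on well-typed terms generated by the axioms of symmetric monoidal categories
  and the three equations for abstraction and evaluation. A single hexagon suffices
  because the symmetry is self-inverse.
\<close>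

inductive smcc_eq ::
  "('o, 'm) signature \<Rightarrow> 'o obj \<Rightarrow> 'o obj \<Rightarrow> ('o, 'm) trm \<Rightarrow> ('o, 'm) trm \<Rightarrow> bool"
  for S :: "('o, 'm) signature" where
  eq_refl: "has_type S f A B \<Longrightarrow> smcc_eq S A B f f"
| eq_sym: "smcc_eq S A B f g \<Longrightarrow> smcc_eq S A B g f"
| eq_trans: "\<lbrakk>smcc_eq S A B f g; smcc_eq S A B g h\<rbrakk> \<Longrightarrow> smcc_eq S A B f h"
| cong_seq: "\<lbrakk>smcc_eq S A B f f'; smcc_eq S B C g g'\<rbrakk> \<Longrightarrow> smcc_eq S A C (f ;; g) (f' ;; g')"
| cong_par: "\<lbrakk>smcc_eq S A B f f'; smcc_eq S C D g g'\<rbrakk> \<Longrightarrow>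
    smcc_eq S (A \<otimes> C) (B \<otimes> D) (f \<parallel> g) (f' \<parallel> g')"
| cong_lam: "smcc_eq S (X \<otimes> A) Y h h' \<Longrightarrow> smcc_eq S A (X \<multimap> Y) (Lam X h) (Lam X h')"

| id_left: "has_type S f A B \<Longrightarrow> smcc_eq S A B (Ident A ;; f) f"
| id_right: "has_type S f A B \<Longrightarrow> smcc_eq S A B (f ;; Ident B) f"
| seq_assoc: "\<lbrakk>has_type S f A B; has_type S g B C; has_type S h C D\<rbrakk> \<Longrightarrow>
    smcc_eq S A D ((f ;; g) ;; h) (f ;; (g ;; h))"

| par_id: "\<lbrakk>A \<in> objs S; B \<in> objs S\<rbrakk> \<Longrightarrow>
    smcc_eq S (A \<otimes> B) (A \<otimes> B) (Ident A \<parallel> Ident B) (Ident (A \<otimes> B))"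
| interchange: "\<lbrakk>has_type S f A B; has_type S g B C; has_type S f' A' B'; has_type S g' B' C'\<rbrakk> \<Longrightarrow>
    smcc_eq S (A \<otimes> A') (C \<otimes> C') ((f ;; g) \<parallel> (f' ;; g')) ((f \<parallel> f') ;; (g \<parallel> g'))"

| assoc_nat: "\<lbrakk>has_type S f A A'; has_type S g B B'; has_type S h C C'\<rbrakk> \<Longrightarrow>
    smcc_eq S ((A \<otimes> B) \<otimes> C) (A' \<otimes> (B' \<otimes> C'))
      (((f \<parallel> g) \<parallel> h) ;; Assoc A' B' C') (Assoc A B C ;; (f \<parallel> (g \<parallel> h)))"
| assoc_iso1: "\<lbrakk>A \<in> objs S; B \<in> objs S; C \<in> objs S\<rbrakk> \<Longrightarrow>
    smcc_eq S ((A \<otimes> B) \<otimes> C) ((A \<otimes> B) \<otimes> C)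
      (Assoc A B C ;; AssocInv A B C) (Ident ((A \<otimes> B) \<otimes> C))"
| assoc_iso2: "\<lbrakk>A \<in> objs S; B \<in> objs S; C \<in> objs S\<rbrakk> \<Longrightarrow>
    smcc_eq S (A \<otimes> (B \<otimes> C)) (A \<otimes> (B \<otimes> C))
      (AssocInv A B C ;; Assoc A B C) (Ident (A \<otimes> (B \<otimes> C)))"
| lunit_nat: "has_type S f A B \<Longrightarrow>
    smcc_eq S (Unit \<otimes> A) B ((Ident Unit \<parallel> f) ;; LUnit B) (LUnit A ;; f)"
| lunit_iso1: "A \<in> objs S \<Longrightarrow>
    smcc_eq S (Unit \<otimes> A) (Unit \<otimes> A) (LUnit A ;; LUnitInv A) (Ident (Unit \<otimes> A))"
| lunit_iso2: "A \<in> objs S \<Longrightarrow> smcc_eq S A A (LUnitInv A ;; LUnit A) (Ident A)"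
| runit_nat: "has_type S f A B \<Longrightarrow>
    smcc_eq S (A \<otimes> Unit) B ((f \<parallel> Ident Unit) ;; RUnit B) (RUnit A ;; f)"
| runit_iso1: "A \<in> objs S \<Longrightarrow>
    smcc_eq S (A \<otimes> Unit) (A \<otimes> Unit) (RUnit A ;; RUnitInv A) (Ident (A \<otimes> Unit))"
| runit_iso2: "A \<in> objs S \<Longrightarrow> smcc_eq S A A (RUnitInv A ;; RUnit A) (Ident A)"
| triangle: "\<lbrakk>A \<in> objs S; B \<in> objs S\<rbrakk> \<Longrightarrow>
    smcc_eq S ((A \<otimes> Unit) \<otimes> B) (A \<otimes> B)
      (Assoc A Unit B ;; (Ident A \<parallel> LUnit B)) (RUnit A \<parallel> Ident B)"
| pentagon: "\<lbrakk>A \<in> objs S; B \<in> objs S; C \<in> objs S; D \<in> objs S\<rbrakk> \<Longrightarrow>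
    smcc_eq S (((A \<otimes> B) \<otimes> C) \<otimes> D) (A \<otimes> (B \<otimes> (C \<otimes> D)))
      (Assoc (A \<otimes> B) C D ;; Assoc A B (C \<otimes> D))
      ((Assoc A B C \<parallel> Ident D) ;; Assoc A (B \<otimes> C) D ;; (Ident A \<parallel> Assoc B C D))"

| sym_nat: "\<lbrakk>has_type S f A A'; has_type S g B B'\<rbrakk> \<Longrightarrow>
    smcc_eq S (A \<otimes> B) (B' \<otimes> A') ((f \<parallel> g) ;; Sym A' B') (Sym A B ;; (g \<parallel> f))"
| sym_inv: "\<lbrakk>A \<in> objs S; B \<in> objs S\<rbrakk> \<Longrightarrow>
    smcc_eq S (A \<otimes> B) (A \<otimes> B) (Sym A B ;; Sym B A) (Ident (A \<otimes> B))"
| sym_unit: "A \<in> objs S \<Longrightarrow> smcc_eq S (A \<otimes> Unit) A (Sym A Unit ;; LUnit A) (RUnit A)"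
| hexagon: "\<lbrakk>A \<in> objs S; B \<in> objs S; C \<in> objs S\<rbrakk> \<Longrightarrow>
    smcc_eq S ((A \<otimes> B) \<otimes> C) (B \<otimes> (C \<otimes> A))
      (Assoc A B C ;; Sym A (B \<otimes> C) ;; Assoc B C A)
      ((Sym A B \<parallel> Ident C) ;; Assoc B A C ;; (Ident B \<parallel> Sym A C))"

| lam_beta: "has_type S h (X \<otimes> A) Y \<Longrightarrow>
    smcc_eq S (A \<otimes> X) Y ((Lam X h \<parallel> Ident X) ;; Eval X Y) (Sym A X ;; h)"
| lam_eta: "\<lbrakk>X \<in> objs S; Y \<in> objs S\<rbrakk> \<Longrightarrow>
    smcc_eq S (X \<multimap> Y) (X \<multimap> Y) (Lam X (Sym X (X \<multimap> Y) ;; Eval X Y)) (Ident (X \<multimap> Y))"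
| lam_nat: "\<lbrakk>X \<in> objs S; has_type S f A B; has_type S g (X \<otimes> B) Y\<rbrakk> \<Longrightarrow>
    smcc_eq S A (X \<multimap> Y) (f ;; Lam X g) (Lam X ((Ident X \<parallel> f) ;; g))"

definition smcc_rel ::
  "('o, 'm) signature \<Rightarrow> 'o obj \<Rightarrow> 'o obj \<Rightarrow> (('o, 'm) trm \<times> ('o, 'm) trm) set" where
  "smcc_rel S A B = {(f, g). smcc_eq S A B f g}"

text \<open>
  The hom-sets of the freely generated symmetric monoidal closed category, and the morphism
  denoted by a term.
\<close>

definition free_hom ::
  "('o, 'm) signature \<Rightarrow> 'o obj \<Rightarrow> 'o obj \<Rightarrow> ('o, 'm) trm set set" where
  "free_hom S A B = {t. has_type S t A B} // smcc_rel S A B"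

definition morphism_of ::
  "('o, 'm) signature \<Rightarrow> 'o obj \<Rightarrow> 'o obj \<Rightarrow> ('o, 'm) trm \<Rightarrow> ('o, 'm) trm set" where
  "morphism_of S A B t = smcc_rel S A B `` {t}"

inductive structural :: "('o, 'm) trm \<Rightarrow> bool" where
  "structural (Ident A)"
| "structural (Sym A B)"
| "structural (Eval X A)"
| "structural (Assoc A B C)"
| "structural (AssocInv A B C)"
| "structural (LUnit A)"
| "structural (LUnitInv A)"
| "structural (RUnit A)"
| "structural (RUnitInv A)"

text \<open>
  Iterated tensor and iterated composition of non-empty lists of terms. The tensor is bracketed
  to the right. Both are left unspecified on the empty list, which is never used:
  the empty tensor and the empty composite are identities, hence structural morphisms.
\<close>

fun par_list :: "('o, 'm) trm list \<Rightarrow> ('o, 'm) trm" where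
  "par_list [f] = f"
| "par_list (f # g # fs) = f \<parallel> par_list (g # fs)"

fun seq_list :: "('o, 'm) trm list \<Rightarrow> ('o, 'm) trm" where
  "seq_list [f] = f"
| "seq_list (f # g # fs) = f ;; seq_list (g # fs)"

text \<open>
  The shape of a hierarchical foliation: the entry \<open>(j, i)\<close> of \<open>fss\<close> is the factor \<open>f\<^sub>j\<^sub>,\<^sub>i\<close>.
  That all its parts belong to the signature and are composable is expressed by \<open>has_type\<close>,
  which also constrains every subterm.
\<close>

inductive hier_foliation :: "('o, 'm) trm \<Rightarrow> bool"
  and foliation_factor :: "('o, 'm) trm \<Rightarrow> bool" where
  "\<lbrakk>fss \<noteq> []; \<forall>fs \<in> set fss. fs \<noteq> [] \<and> (\<forall>f \<in> set fs. foliation_factor f)\<rbrakk> \<Longrightarrow>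
    hier_foliation (seq_list (map par_list fss))"
| "foliation_factor (Gen m)"
| "structural f \<Longrightarrow> foliation_factor f"
| "hier_foliation f \<Longrightarrow> foliation_factor (Lam X f)"

lemma objs_simps [simp]:
  "Unit \<in> objs S"
  "Atom a \<in> objs S \<longleftrightarrow> a \<in> gen_objs S"
  "A \<otimes> B \<in> objs S \<longleftrightarrow> A \<in> objs S \<and> B \<in> objs S"
  "A \<multimap> B \<in> objs S \<longleftrightarrow> A \<in> objs S \<and> B \<in> objs S"
  by (auto intro: objs.intros elim: objs.cases)

lemma has_type_objs:
  assumes "closed_monoidal_signature S" and "has_type S f A B"
  shows "A \<in> objs S \<and> B \<in> objs S"
  using assms(2,1)
  by induction (auto simp: closed_monoidal_signature_def)

lemma smcc_eq_typed:
  assumes "closed_monoidal_signature S" and "smcc_eq S A B f g"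
  shows "has_type S f A B \<and> has_type S g A B"
proof -
  note [intro] = objs.intros
  have [dest]: "A \<in> objs S" "B \<in> objs S" if "A \<otimes> B \<in> objs S" for A B
    using that by auto
  note [dest] = has_type_objs[OF assms(1)]
  show ?thesis
    using assms(2)
    by induction
      ((elim conjE)?; intro conjI; (assumption | rule has_type.intros | blast)+)+
qed

lemma equiv_smcc_rel:
  assumes "closed_monoidal_signature S"
  shows "equiv {t. has_type S t A B} (smcc_rel S A B)"
  using smcc_eq_typed[OF assms]
  by (intro equivI refl_onI symI transI)
    (auto simp: smcc_rel_def intro: eq_refl eq_sym eq_trans)

end

theory Submission
  imports Defs
begin

text \<open>
  Terms with a presentation as a hierarchical foliation contain the generators and structural
  morphisms and are closed under composition (concatenate the layers), under abstraction, and
  under \<open>Ident C \<parallel> _\<close> (prepend an identity to each layer). Conjugating by symmetries yields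
  closure under \<open>_ \<parallel> Ident C\<close> without rebracketing any layer, and
  \<open>f \<parallel> g = (f \<parallel> id) ;; (id \<parallel> g)\<close> gives arbitrary tensors.
\<close>

inductive_cases has_type_SeqE: "has_type S (f ;; g) A C"

lemma seq_list_Cons: "fs \<noteq> [] \<Longrightarrow> seq_list (f # fs) = f ;; seq_list fs"
  by (cases fs) auto

lemma par_list_Cons: "fs \<noteq> [] \<Longrightarrow> par_list (f # fs) = f \<parallel> par_list fs"
  by (cases fs) auto

text \<open>Holds only up to \<open>smcc_eq\<close>: \<open>seq_list\<close> brackets to the right,
  so each layer of \<open>fs\<close> has to be moved across the composite by one use of
  \<open>seq_assoc\<close>.\<close>

lemma seq_list_append:
  assumes "fs \<noteq> []" "gs \<noteq> []" "has_type S (seq_list fs) A B" "has_type S (seq_list gs) B C"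
  shows "smcc_eq S A C (seq_list fs ;; seq_list gs) (seq_list (fs @ gs))"
  using assms
proof (induction fs arbitrary: A rule: list_nonempty_induct)
  case (single f)
  then show ?case
    by (auto simp: seq_list_Cons intro: eq_refl ty_seq)
next
  case (cons f fs)
  \<comment> \<open>Inverting the typing rule for \<open>;;\<close> supplies the intermediate
    object; the induction hypothesis is then used with \<open>D\<close> as source, hence
    \<open>A\<close> is arbitrary.\<close>
  then obtain D where D: "has_type S f A D" "has_type S (seq_list fs) D B"
    by (auto simp: seq_list_Cons elim: has_type_SeqE)
  with cons have "smcc_eq S A C (f ;; (seq_list fs ;; seq_list gs)) (f ;; seq_list (fs @ gs))"
    by (auto intro: cong_seq eq_refl)
  with D cons.hyps cons.prems show ?case
    by (auto simp: seq_list_Cons intro: eq_trans seq_assoc)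
qed

text \<open>Functoriality of tensoring with \<open>C\<close> on the left: at each layer
  \<open>Ident C\<close> is split as \<open>Ident C ;; Ident C\<close>, and interchange passes one
  copy to that layer and the other to the rest.\<close>

lemma Ident_par_seq_list:
  assumes "C \<in> objs S" "fs \<noteq> []" "has_type S (seq_list fs) A B"
  shows "smcc_eq S (C \<otimes> A) (C \<otimes> B) (Ident C \<parallel> seq_list fs)
    (seq_list (map (\<lambda>f. Ident C \<parallel> f) fs))"
  using assms(2,3)
proof (induction fs arbitrary: A rule: list_nonempty_induct)
  case (single f)
  with assms(1) show ?case
    by (auto intro: eq_refl ty_par ty_id)
next
  case (cons f fs)
  then obtain D where D: "has_type S f A D" "has_type S (seq_list fs) D B"
    by (auto simp: seq_list_Cons elim: has_type_SeqE)
  have id: "has_type S (Ident C) C C"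
    using assms(1) by (rule ty_id)
  have "smcc_eq S (C \<otimes> A) (C \<otimes> B) (Ident C \<parallel> (f ;; seq_list fs))
      ((Ident C ;; Ident C) \<parallel> (f ;; seq_list fs))"
    using D by (intro cong_par eq_sym[OF id_left[OF id]] eq_refl ty_seq)
  moreover have "smcc_eq S (C \<otimes> A) (C \<otimes> B) ((Ident C ;; Ident C) \<parallel> (f ;; seq_list fs))
      ((Ident C \<parallel> f) ;; (Ident C \<parallel> seq_list fs))"
    using D by (rule interchange[OF id id])
  moreover have "smcc_eq S (C \<otimes> A) (C \<otimes> B) ((Ident C \<parallel> f) ;; (Ident C \<parallel> seq_list fs))
      ((Ident C \<parallel> f) ;; seq_list (map (\<lambda>f. Ident C \<parallel> f) fs))"
    using D by (intro cong_seq[OF eq_refl cons.IH] ty_par id)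
  ultimately show ?case
    using cons.hyps by (auto simp: seq_list_Cons intro: eq_trans)
qed

lemma hier_foliationE:
  assumes "hier_foliation t"
  obtains fss where "fss \<noteq> []" "\<forall>fs \<in> set fss. fs \<noteq> [] \<and> (\<forall>f \<in> set fs. foliation_factor f)"
    "t = seq_list (map par_list fss)"
  using assms by (auto elim: hier_foliation.cases)

lemma hier_foliation_factor: "foliation_factor f \<Longrightarrow> hier_foliation f"
  using hier_foliation_foliation_factor.intros(1)[of "[[f]]"] by simp

text \<open>Stated up to \<open>smcc_eq\<close> because a term itself need not have the required
  shape, for instance when its composites are bracketed to the left.\<close>

definition foliable ::
  "('o, 'm) signature \<Rightarrow> 'o obj \<Rightarrow> 'o obj \<Rightarrow> ('o, 'm) trm \<Rightarrow> bool" where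
  "foliable S A B t \<longleftrightarrow> (\<exists>t'. hier_foliation t' \<and> smcc_eq S A B t t')"

lemma foliable_factor:
  "foliation_factor f \<Longrightarrow> has_type S f A B \<Longrightarrow> foliable S A B f"
  unfolding foliable_def using hier_foliation_factor eq_refl by blast

lemma foliable_structural:
  "structural f \<Longrightarrow> has_type S f A B \<Longrightarrow> foliable S A B f"
  by (rule foliable_factor[OF hier_foliation_foliation_factor.intros(3)])

lemma foliable_eq:
  "foliable S A B f \<Longrightarrow> smcc_eq S A B g f \<Longrightarrow> foliable S A B g"
  unfolding foliable_def using eq_trans by blast

context
  fixes S :: "('o, 'm) signature"
  assumes sig: "closed_monoidal_signature S"
begin

lemma foliable_Seq:
  assumes "foliable S A B f" "foliable S B C g"
  shows "foliable S A C (f ;; g)"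
proof -
  obtain f' g' where f': "hier_foliation f'" "smcc_eq S A B f f'"
    and g': "hier_foliation g'" "smcc_eq S B C g g'"
    using assms unfolding foliable_def by blast
  obtain fss where fss: "fss \<noteq> []" "f' = seq_list (map par_list fss)"
    "\<forall>fs \<in> set fss. fs \<noteq> [] \<and> (\<forall>f \<in> set fs. foliation_factor f)"
    using f'(1) by (elim hier_foliationE)
  obtain gss where gss: "gss \<noteq> []" "g' = seq_list (map par_list gss)"
    "\<forall>fs \<in> set gss. fs \<noteq> [] \<and> (\<forall>f \<in> set fs. foliation_factor f)"
    using g'(1) by (elim hier_foliationE)
  have "hier_foliation (seq_list (map par_list (fss @ gss)))"
    using fss gss by (intro hier_foliation_foliation_factor.intros(1)) auto
  \<comment> \<open>Reassociation needs typed terms; since \<open>smcc_eq\<close> relates only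
    well-typed terms, \<open>f'\<close> and \<open>g'\<close> inherit their types from the equations
    with \<open>f\<close> and \<open>g\<close>.\<close>
  moreover have "smcc_eq S A C (f' ;; g') (seq_list (map par_list (fss @ gss)))"
    using fss gss smcc_eq_typed[OF sig f'(2)] smcc_eq_typed[OF sig g'(2)]
    by (auto intro: seq_list_append)
  ultimately show ?thesis
    unfolding foliable_def using cong_seq[OF f'(2) g'(2)] eq_trans by blast
qed

lemma foliable_Ident_Par:
  assumes "C \<in> objs S" "foliable S A B f"
  shows "foliable S (C \<otimes> A) (C \<otimes> B) (Ident C \<parallel> f)"
proof -
  obtain f' where f': "hier_foliation f'" "smcc_eq S A B f f'"
    using assms(2) unfolding foliable_def by blast
  obtain fss where fss: "fss \<noteq> []" "f' = seq_list (map par_list fss)"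
    "\<forall>fs \<in> set fss. fs \<noteq> [] \<and> (\<forall>f \<in> set fs. foliation_factor f)"
    using f'(1) by (elim hier_foliationE)
  \<comment> \<open>As \<open>par_list\<close> brackets to the right, prepending
    \<open>Ident C\<close> to a nonempty layer yields literally \<open>Ident C \<parallel> _\<close>
    of that layer, so no associators appear.\<close>
  let ?t = "seq_list (map par_list (map (Cons (Ident C)) fss))"
  have "hier_foliation ?t"
    using fss by (intro hier_foliation_foliation_factor.intros(1))
      (auto intro: hier_foliation_foliation_factor.intros structural.intros)
  moreover have "map par_list (map (Cons (Ident C)) fss)
      = map (\<lambda>f. Ident C \<parallel> f) (map par_list fss)"
    using fss(3) by (auto simp: par_list_Cons)
  then have "smcc_eq S (C \<otimes> A) (C \<otimes> B) (Ident C \<parallel> f') ?t"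
    using Ident_par_seq_list[OF assms(1), of "map par_list fss" A B] fss
      smcc_eq_typed[OF sig f'(2)] by (simp del: map_map)
  moreover have "smcc_eq S (C \<otimes> A) (C \<otimes> B) (Ident C \<parallel> f) (Ident C \<parallel> f')"
    using assms(1) f'(2) by (intro cong_par eq_refl ty_id)
  ultimately show ?thesis
    unfolding foliable_def using eq_trans by blast
qed

text \<open>Insert \<open>Sym B C ;; Sym C B\<close>, which is an identity, after
  \<open>f \<parallel> Ident C\<close>, then slide the first symmetry to the front by
  naturality.\<close>

lemma Par_Ident_eq_conj_Sym:
  assumes "C \<in> objs S" "has_type S f A B"
  shows "smcc_eq S (A \<otimes> C) (B \<otimes> C) (f \<parallel> Ident C) (Sym A C ;; (Ident C \<parallel> f) ;; Sym C B)"
proof -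
  have AB: "A \<in> objs S" "B \<in> objs S"
    using has_type_objs[OF sig assms(2)] by auto
  have id: "has_type S (Ident C) C C"
    using assms(1) by (rule ty_id)
  have fC: "has_type S (f \<parallel> Ident C) (A \<otimes> C) (B \<otimes> C)"
    using assms(2) id by (rule ty_par)
  have "smcc_eq S (A \<otimes> C) (B \<otimes> C) (f \<parallel> Ident C) ((f \<parallel> Ident C) ;; Ident (B \<otimes> C))"
    by (rule eq_sym[OF id_right[OF fC]])
  moreover have "smcc_eq S (A \<otimes> C) (B \<otimes> C) ((f \<parallel> Ident C) ;; Ident (B \<otimes> C))
      ((f \<parallel> Ident C) ;; (Sym B C ;; Sym C B))"
    using AB assms(1) by (intro cong_seq[OF eq_refl[OF fC]] eq_sym[OF sym_inv])
  moreover have "smcc_eq S (A \<otimes> C) (B \<otimes> C) ((f \<parallel> Ident C) ;; (Sym B C ;; Sym C B))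
      ((f \<parallel> Ident C) ;; Sym B C ;; Sym C B)"
    using AB assms(1) by (intro eq_sym[OF seq_assoc[OF fC ty_sym ty_sym]])
  moreover have "smcc_eq S (A \<otimes> C) (B \<otimes> C) ((f \<parallel> Ident C) ;; Sym B C ;; Sym C B)
      (Sym A C ;; (Ident C \<parallel> f) ;; Sym C B)"
    using AB assms(1) by (intro cong_seq[OF sym_nat[OF assms(2) id]] eq_refl ty_sym)
  ultimately show ?thesis
    by (blast intro: eq_trans)
qed

lemma foliable_Par_Ident:
  assumes "C \<in> objs S" "has_type S f A B" "foliable S A B f"
  shows "foliable S (A \<otimes> C) (B \<otimes> C) (f \<parallel> Ident C)"
proof -
  have sym: "foliable S (X \<otimes> Y) (Y \<otimes> X) (Sym X Y)" if "X \<in> objs S" "Y \<in> objs S" for X Y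
    using that by (intro foliable_structural structural.intros ty_sym)
  have "foliable S (A \<otimes> C) (B \<otimes> C) (Sym A C ;; (Ident C \<parallel> f) ;; Sym C B)"
    using has_type_objs[OF sig assms(2)] assms
    by (blast intro: foliable_Seq sym foliable_Ident_Par)
  then show ?thesis
    by (rule foliable_eq[OF _ Par_Ident_eq_conj_Sym[OF assms(1,2)]])
qed

lemma foliable_Par:
  assumes f: "has_type S f A B" "foliable S A B f" and g: "has_type S g C D" "foliable S C D g"
  shows "foliable S (A \<otimes> C) (B \<otimes> D) (f \<parallel> g)"
proof -
  have objs: "B \<in> objs S" "C \<in> objs S"
    using has_type_objs[OF sig f(1)] has_type_objs[OF sig g(1)] by auto
  \<comment> \<open>Padding with identities makes both tensor factors composites of length two, as
    interchange demands; \<open>f\<close> acts first, then \<open>g\<close>.\<close>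
  have "smcc_eq S (A \<otimes> C) (B \<otimes> D) (f \<parallel> g) ((f ;; Ident B) \<parallel> (Ident C ;; g))"
    using f g by (intro cong_par eq_sym[OF id_left] eq_sym[OF id_right])
  moreover have "smcc_eq S (A \<otimes> C) (B \<otimes> D) ((f ;; Ident B) \<parallel> (Ident C ;; g))
      ((f \<parallel> Ident C) ;; (Ident B \<parallel> g))"
    by (rule interchange[OF f(1) ty_id[OF objs(1)] ty_id[OF objs(2)] g(1)])
  moreover have "foliable S (A \<otimes> C) (B \<otimes> D) ((f \<parallel> Ident C) ;; (Ident B \<parallel> g))"
    using f g objs by (blast intro: foliable_Seq foliable_Par_Ident foliable_Ident_Par)
  ultimately show ?thesis
    by (blast intro: foliable_eq)
qed

text \<open>This is where the hierarchy enters: a foliation of \<open>h\<close> becomes the body of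
  a single factor, which forms a one-layer foliation by itself.\<close>

lemma foliable_Lam:
  assumes "foliable S (X \<otimes> A) Y h"
  shows "foliable S A (X \<multimap> Y) (Lam X h)"
  using assms unfolding foliable_def
  by (blast intro: cong_lam hier_foliation_factor hier_foliation_foliation_factor.intros(4))

lemma has_type_foliable: "has_type S f A B \<Longrightarrow> foliable S A B f"
proof (induction rule: has_type.induct)
  case (ty_gen m)
  then show ?case
    by (intro foliable_factor hier_foliation_foliation_factor.intros has_type.intros)
next
  case (ty_seq f A B g C)
  then show ?case by (blast intro: foliable_Seq)
next
  case (ty_par f A B g C D)
  then show ?case by (blast intro: foliable_Par)
next
  case (ty_lam h X A Y)
  then show ?case by (blast intro: foliable_Lam)
\<comment> \<open>The nine remaining typing rules are those of the structural morphisms.\<close>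
qed (intro foliable_structural structural.intros has_type.intros; assumption)+

end

theorem mainTheorem4:
  fixes S :: "('o, 'm) signature" and A B :: "'o obj" and f :: "('o, 'm) trm set"
  assumes "closed_monoidal_signature S"
    and "f \<in> free_hom S A B"
  shows "\<exists>t. hier_foliation t \<and> has_type S t A B \<and> f = morphism_of S A B t"
proof -
  \<comment> \<open>Any representative of the class \<open>f\<close> will do, since the foliation of
    \<open>s\<close> is equal to \<open>s\<close> in the free category and so denotes the same
    class.\<close>
  obtain s where s: "has_type S s A B" "f = morphism_of S A B s"
    using assms(2) by (auto simp: free_hom_def morphism_of_def elim: quotientE)
  obtain t where t: "hier_foliation t" "smcc_eq S A B s t"
    using has_type_foliable[OF assms(1) s(1)] unfolding foliable_def by blast
  have "f = morphism_of S A B t"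
    unfolding s(2) morphism_of_def
    by (rule equiv_class_eq[OF equiv_smcc_rel[OF assms(1)]]) (simp add: smcc_rel_def t(2))
  with t smcc_eq_typed[OF assms(1) t(2)] show ?thesis
    by blast
qed

end
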